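(* Consider the semi-discrete upwind summation-by-parts (SBP) approximation of the 2D2V Vlasov--Maxwell system with periodic boundary conditions in all four phase-space directions, i.e. the system of ODEs for the grid functions $\mathbf f(t)$ (on the phase-space grid) and $\mathbf E_x(t),\mathbf B_z(t),\mathbf E_y(t)$ (on the spatial grid) $$ \begin{aligned} \partial_t \mathbf f &= -v\,\mathsf D_x\mathbf f - w\,\mathsf D_y \mathbf f-(\mathbf E_x+w\mathbf B_z)\,\mathsf D_v\mathbf f-(\mathbf E_y-v\mathbf B_z)\,\mathsf D_w\mathbf f+k_s\sum_{z\in\{x,y,v,w\}}\alpha_z\mathsf H_z^{-1}\mathsf S_z\mathbf f,\\ \partial_t \mathbf E_x&=\mathsf D_y\mathbf B_z-\mathbf J_x+k_s\sum_{z\in\{x,y\}}\alpha_z\mathsf H_z^{-1}\mathsf S_z\mathbf E_x,\\ \partial_t \mathbf B_z&=\mathsf D_y\mathbf E_x-\mathsf D_x\mathbf E_y+k_s\sum_{z\in\{x,y\}}\alpha_z\mathsf H_z^{-1}\mathsf S_z\mathbf B_z,\\ \partial_t \mathbf E_y&=-\mathsf D_x\mathbf B_z-\mathbf J_y+k_s\sum_{z\in\{x,y\}}\alpha_z\mathsf H_z^{-1}\mathsf S_z\mathbf E_y, \end{aligned} $$ for $t>0$, with given initial values and $k_s\ge 1$. Then every solution satisfies the discrete $L^2$ stability estimate for the distribution function: for all $t>0$, $$ \partial_t\|\mathbf f\|_{\mathsf H_\Omega}^2\le 0 . $$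
   Context: Grid. The phase space is $\Omega=\Omega_{\mathbf x}\times\Omega_{\mathbf v}$, $\Omega_{\mathbf x}=[0,L_x]\times[0,L_y]$, $\Omega_{\mathbf v}=[0,L_v]\times[0,L_w]$. For $z\in\{x,y,v,w\}$ the grid in direction $z$ is $z_i=ih_z$, $h_z=L_z/m_z$, with periodic indexing (indices modulo $m_z$), so there are $m_z$ grid points per direction. $\mathbf f=(f_{ijkl})$ is a real grid function on the points $(x_i,y_j,v_k,w_l)$; $\mathbf E_x,\mathbf B_z,\mathbf E_y$ are real grid functions on the points $(x_i,y_j)$, viewed when needed as phase-space grid functions constant in $v,w$. One-dimensional periodic SBP operators. In each direction, with step $h$, $\mathsf D_+$ and $\mathsf D_-$ are periodic upwind SBP operators approximating the first derivative: they are given by periodic stencils $(\mathsf D_\pm g)_i=\sum_{r=-p}^{p}c_r^{\pm}g_{i+r}$ (indices modulo $m$) that are consistent, $\sum_r c^\pm_r=0$ and $h\sum_r r\,c^\pm_r=1$, and, with quadrature matrix $\mathsf H=h\mathsf I$, they satisfy $\mathsf D_\pm=\mathsf H^{-1}\mathsf Q_\pm$ with $\mathsf Q_++\mathsf Q_-^{T}=0$ and $\mathsf Q_++\mathsf Q_+^{T}=2\mathsf S$, $\mathsf S$ negative semidefinite. The central operator is $\mathsf D_1=\tfrac12(\mathsf D_++\mathsf D_-)=\mathsf H^{-1}\mathsf Q$ with $\mathsf Q$ skew-symmetric, and $\tfrac12(\mathsf D_+-\mathsf D_-)=\mathsf H^{-1}\mathsf S$. (For non-periodic grids there is an additional boundary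 matrix in $\mathsf D_\pm$ and $\mathsf D_1$; it is absent here because of periodicity.) $\mathsf D_z$, $\mathsf D_{z,\pm}$, $\mathsf H_z^{-1}\mathsf S_z$ denote these operators acting in the direction $z\in\{x,y,v,w\}$ (Kronecker product with identities in the other directions). Norm. $\|\mathbf f\|_{\mathsf H_\Omega}^2=h_xh_yh_vh_w\sum_{i,j,k,l}f_{ijkl}^2$. In the ODE system the products of $v$ (value $v_k$), $w$ (value $w_l$), $\mathbf E_x,\mathbf E_y,\mathbf B_z$ with grid functions are pointwise. Current densities. $J_{x,ij}=h_vh_w\sum_{k,l}v_kf_{ijkl}$, $J_{y,ij}=h_vh_w\sum_{k,l}w_lf_{ijkl}$. Stabilization coefficients. $\alpha_z$ is the maximum absolute eigenvalue of the (discretized) coefficient matrix of $\partial_z$ in the system for $(f,E_x,B_z,E_y)$: $\alpha_x=\max(\max_k|v_k|,1)$, $\alpha_y=\max(\max_l|w_l|,1)$, $\alpha_v=\max_{i,j,l}|E_{x,ij}+w_lB_{z,ij}|$, $\alpha_w=\max_{i,j,k}|E_{y,ij}-v_kB_{z,ij}|$. *)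

theory Defs
  imports Complex_Main "Jordan_Normal_Form.Matrix"
begin

text \<open>
  One coordinate direction \<open>z\<close>: the length \<open>L\<^sub>z\<close>, the number \<open>m\<^sub>z\<close> of grid points, and the
  half-width \<open>p\<close> and the coefficients \<open>c\<^sup>+\<^sub>r\<close>, \<open>c\<^sup>-\<^sub>r\<close> (\<open>-p \<le> r \<le> p\<close>) of its two upwind stencils.
  Grid functions are functions of natural number indices; only indices below \<open>m\<^sub>z\<close> matter.
\<close>

record direction =
  len :: real
  pts :: nat
  width :: nat
  cplus :: "int \<Rightarrow> real"
  cminus :: "int \<Rightarrow> real"

definition stp :: "direction \<Rightarrow> real" where
  "stp d = len d / real (pts d)"

definition node :: "direction \<Rightarrow> nat \<Rightarrow> real" where
  "node d i = real i * stp d"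

definition stencil :: "nat \<Rightarrow> nat \<Rightarrow> (int \<Rightarrow> real) \<Rightarrow> (nat \<Rightarrow> real) \<Rightarrow> nat \<Rightarrow> real" where
  "stencil m p c g i = (\<Sum>r = - int p..int p. c r * g (nat ((int i + r) mod int m)))"

text \<open>Column \<open>j\<close> is the stencil applied to the \<open>j\<close>-th unit grid function.\<close>

definition stencil_mat :: "nat \<Rightarrow> nat \<Rightarrow> (int \<Rightarrow> real) \<Rightarrow> real mat" where
  "stencil_mat m p c = mat m m (\<lambda>(i, j). stencil m p c (\<lambda>n. if n = j then 1 else 0) i)"

definition act :: "real mat \<Rightarrow> (nat \<Rightarrow> real) \<Rightarrow> nat \<Rightarrow> real" where
  "act A g i = (A *\<^sub>v vec (dim_col A) g) $ i"

lemma act_stencil_mat: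
  assumes "i < m"
  shows "act (stencil_mat m p c) g i = stencil m p c g i"
proof -
  let ?s = "\<lambda>r. nat ((int i + r) mod int m)"
  have s: "?s r < m" for r
    using assms by (simp add: nat_less_iff)
  have "act (stencil_mat m p c) g i = (\<Sum>j<m. stencil_mat m p c $$ (i, j) * g j)"
    using assms unfolding act_def stencil_mat_def scalar_prod_def
    by (auto simp: scalar_prod_def lessThan_atLeast0 intro!: sum.cong)
  also have "\<dots> = (\<Sum>j<m. (\<Sum>r = - int p..int p. c r * (if ?s r = j then 1 else 0)) * g j)"
    using assms by (intro sum.cong) (auto simp: stencil_mat_def stencil_def)
  also have "\<dots> = (\<Sum>j<m. \<Sum>r = - int p..int p. if j = ?s r then c r * g j else 0)"
    unfolding sum_distrib_right by (intro sum.cong) auto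
  also have "\<dots> = (\<Sum>r = - int p..int p. \<Sum>j<m. if j = ?s r then c r * g j else 0)"
    by (rule sum.swap)
  also have "\<dots> = stencil m p c g i"
    unfolding stencil_def using s by (intro sum.cong) auto
  finally show ?thesis .
qed

definition Dplus :: "direction \<Rightarrow> real mat" where
  "Dplus d = stencil_mat (pts d) (width d) (cplus d)"

definition Dminus :: "direction \<Rightarrow> real mat" where
  "Dminus d = stencil_mat (pts d) (width d) (cminus d)"

definition Hmat :: "direction \<Rightarrow> real mat" where
  "Hmat d = stp d \<cdot>\<^sub>m 1\<^sub>m (pts d)"

definition Hinv :: "direction \<Rightarrow> real mat" where
  "Hinv d = inverse (stp d) \<cdot>\<^sub>m 1\<^sub>m (pts d)"

definition Qplus :: "direction \<Rightarrow> real mat" where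
  "Qplus d = Hmat d * Dplus d"

definition Qminus :: "direction \<Rightarrow> real mat" where
  "Qminus d = Hmat d * Dminus d"

definition Smat :: "direction \<Rightarrow> real mat" where
  "Smat d = (1/2) \<cdot>\<^sub>m (Qplus d + transpose_mat (Qplus d))"

definition D1 :: "direction \<Rightarrow> real mat" where
  "D1 d = (1/2) \<cdot>\<^sub>m (Dplus d + Dminus d)"

definition neg_semidef :: "real mat \<Rightarrow> bool" where
  "neg_semidef A \<longleftrightarrow> (\<forall>u \<in> carrier_vec (dim_row A). u \<bullet> (A *\<^sub>v u) \<le> 0)"

definition consistent :: "real \<Rightarrow> nat \<Rightarrow> (int \<Rightarrow> real) \<Rightarrow> bool" where
  "consistent h p c \<longleftrightarrow>
     (\<Sum>r = - int p..int p. c r) = 0 \<and> h * (\<Sum>r = - int p..int p. real_of_int r * c r) = 1"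

text \<open>
  Skew-symmetry of \<open>H D\<^sub>1\<close> and \<open>(D\<^sub>+ - D\<^sub>-)/2 = H\<inverse> S\<close> are consequences of these conditions.
\<close>

definition periodic_upwind_sbp :: "direction \<Rightarrow> bool" where
  "periodic_upwind_sbp d \<longleftrightarrow>
     len d > 0 \<and> pts d > 0 \<and>
     consistent (stp d) (width d) (cplus d) \<and>
     consistent (stp d) (width d) (cminus d) \<and>
     Qplus d + transpose_mat (Qminus d) = 0\<^sub>m (pts d) (pts d) \<and>
     neg_semidef (Smat d)"

type_synonym grid2 = "nat \<Rightarrow> nat \<Rightarrow> real"
type_synonym grid4 = "nat \<Rightarrow> nat \<Rightarrow> nat \<Rightarrow> nat \<Rightarrow> real"

text \<open>Kronecker products with identity matrices: a one-dimensional matrix acts on one index.\<close>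

definition act4x :: "real mat \<Rightarrow> grid4 \<Rightarrow> grid4" where
  "act4x A f i j k l = act A (\<lambda>n. f n j k l) i"

definition act4y :: "real mat \<Rightarrow> grid4 \<Rightarrow> grid4" where
  "act4y A f i j k l = act A (\<lambda>n. f i n k l) j"

definition act4v :: "real mat \<Rightarrow> grid4 \<Rightarrow> grid4" where
  "act4v A f i j k l = act A (\<lambda>n. f i j n l) k"

definition act4w :: "real mat \<Rightarrow> grid4 \<Rightarrow> grid4" where
  "act4w A f i j k l = act A (\<lambda>n. f i j k n) l"

definition act2x :: "real mat \<Rightarrow> grid2 \<Rightarrow> grid2" where
  "act2x A g i j = act A (\<lambda>n. g n j) i"

definition act2y :: "real mat \<Rightarrow> grid2 \<Rightarrow> grid2" where
  "act2y A g i j = act A (\<lambda>n. g i n) j"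

definition norm_sq :: "direction \<Rightarrow> direction \<Rightarrow> direction \<Rightarrow> direction \<Rightarrow> grid4 \<Rightarrow> real" where
  "norm_sq X Y V W f =
     stp X * stp Y * stp V * stp W *
     (\<Sum>i<pts X. \<Sum>j<pts Y. \<Sum>k<pts V. \<Sum>l<pts W. (f i j k l)\<^sup>2)"

definition Jx :: "direction \<Rightarrow> direction \<Rightarrow> grid4 \<Rightarrow> grid2" where
  "Jx V W f i j = stp V * stp W * (\<Sum>k<pts V. \<Sum>l<pts W. node V k * f i j k l)"

definition Jy :: "direction \<Rightarrow> direction \<Rightarrow> grid4 \<Rightarrow> grid2" where
  "Jy V W f i j = stp V * stp W * (\<Sum>k<pts V. \<Sum>l<pts W. node W l * f i j k l)"

text \<open>
  Maximum absolute eigenvalues of the coefficient matrices of \<open>\<partial>\<^sub>z\<close> over the grid: for \<open>z = x, y\<close> the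
  matrix has the transport eigenvalue \<open>v\<^sub>k\<close> or \<open>w\<^sub>l\<close> and the Maxwell eigenvalues \<open>0, 1, -1\<close>; for
  \<open>z = v, w\<close> its only nonzero entry is the Lorentz force component.
\<close>

definition alpha_x :: "direction \<Rightarrow> real" where
  "alpha_x V = max (Max ((\<lambda>k. \<bar>node V k\<bar>) ` {..<pts V})) 1"

definition alpha_y :: "direction \<Rightarrow> real" where
  "alpha_y W = max (Max ((\<lambda>l. \<bar>node W l\<bar>) ` {..<pts W})) 1"

definition alpha_v :: "direction \<Rightarrow> direction \<Rightarrow> direction \<Rightarrow> grid2 \<Rightarrow> grid2 \<Rightarrow> real" where
  "alpha_v X Y W E_x B_z =
     Max ((\<lambda>(i, j, l). \<bar>E_x i j + node W l * B_z i j\<bar>) ` ({..<pts X} \<times> {..<pts Y} \<times> {..<pts W}))"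

definition alpha_w :: "direction \<Rightarrow> direction \<Rightarrow> direction \<Rightarrow> grid2 \<Rightarrow> grid2 \<Rightarrow> real" where
  "alpha_w X Y V E_y B_z =
     Max ((\<lambda>(i, j, k). \<bar>E_y i j - node V k * B_z i j\<bar>) ` ({..<pts X} \<times> {..<pts Y} \<times> {..<pts V}))"

definition rhs_f ::
  "direction \<Rightarrow> direction \<Rightarrow> direction \<Rightarrow> direction \<Rightarrow> real \<Rightarrow>
   grid4 \<Rightarrow> grid2 \<Rightarrow> grid2 \<Rightarrow> grid2 \<Rightarrow> grid4" where
  "rhs_f X Y V W ks f E_x B_z E_y i j k l =
     - node V k * act4x (D1 X) f i j k l
     - node W l * act4y (D1 Y) f i j k l
     - (E_x i j + node W l * B_z i j) * act4v (D1 V) f i j k l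
     - (E_y i j - node V k * B_z i j) * act4w (D1 W) f i j k l
     + ks * (alpha_x V * act4x (Hinv X * Smat X) f i j k l
           + alpha_y W * act4y (Hinv Y * Smat Y) f i j k l
           + alpha_v X Y W E_x B_z * act4v (Hinv V * Smat V) f i j k l
           + alpha_w X Y V E_y B_z * act4w (Hinv W * Smat W) f i j k l)"

definition dissip2 ::
  "direction \<Rightarrow> direction \<Rightarrow> direction \<Rightarrow> direction \<Rightarrow> real \<Rightarrow> grid2 \<Rightarrow> grid2" where
  "dissip2 X Y V W ks g i j =
     ks * (alpha_x V * act2x (Hinv X * Smat X) g i j
         + alpha_y W * act2y (Hinv Y * Smat Y) g i j)"

definition rhs_Ex ::
  "direction \<Rightarrow> direction \<Rightarrow> direction \<Rightarrow> direction \<Rightarrow> real \<Rightarrow>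
   grid4 \<Rightarrow> grid2 \<Rightarrow> grid2 \<Rightarrow> grid2 \<Rightarrow> grid2" where
  "rhs_Ex X Y V W ks f E_x B_z E_y i j =
     act2y (D1 Y) B_z i j - Jx V W f i j + dissip2 X Y V W ks E_x i j"

definition rhs_Bz ::
  "direction \<Rightarrow> direction \<Rightarrow> direction \<Rightarrow> direction \<Rightarrow> real \<Rightarrow>
   grid4 \<Rightarrow> grid2 \<Rightarrow> grid2 \<Rightarrow> grid2 \<Rightarrow> grid2" where
  "rhs_Bz X Y V W ks f E_x B_z E_y i j =
     act2y (D1 Y) E_x i j - act2x (D1 X) E_y i j + dissip2 X Y V W ks B_z i j"

definition rhs_Ey ::
  "direction \<Rightarrow> direction \<Rightarrow> direction \<Rightarrow> direction \<Rightarrow> real \<Rightarrow>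
   grid4 \<Rightarrow> grid2 \<Rightarrow> grid2 \<Rightarrow> grid2 \<Rightarrow> grid2" where
  "rhs_Ey X Y V W ks f E_x B_z E_y i j =
     - act2x (D1 X) B_z i j - Jy V W f i j + dissip2 X Y V W ks E_y i j"

text \<open>
  Scalar initial value problem: \<open>u\<close> takes the value \<open>u0\<close> at time 0, is continuous there from the
  right, and satisfies \<open>u'(t) = F t\<close> for all \<open>t > 0\<close>.
\<close>

definition ivp :: "real \<Rightarrow> (real \<Rightarrow> real) \<Rightarrow> (real \<Rightarrow> real) \<Rightarrow> bool" where
  "ivp u0 u F \<longleftrightarrow>
     u 0 = u0 \<and> continuous_on {0..} u \<and> (\<forall>t>0. (u has_real_derivative F t) (at t))"

definition vm_solution ::
  "direction \<Rightarrow> direction \<Rightarrow> direction \<Rightarrow> direction \<Rightarrow> real \<Rightarrow>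
   grid4 \<Rightarrow> grid2 \<Rightarrow> grid2 \<Rightarrow> grid2 \<Rightarrow>
   (real \<Rightarrow> grid4) \<Rightarrow> (real \<Rightarrow> grid2) \<Rightarrow> (real \<Rightarrow> grid2) \<Rightarrow> (real \<Rightarrow> grid2) \<Rightarrow> bool" where
  "vm_solution X Y V W ks f0 E_x0 B_z0 E_y0 f E_x B_z E_y \<longleftrightarrow>
     (\<forall>i<pts X. \<forall>j<pts Y. \<forall>k<pts V. \<forall>l<pts W.
        ivp (f0 i j k l) (\<lambda>t. f t i j k l)
          (\<lambda>t. rhs_f X Y V W ks (f t) (E_x t) (B_z t) (E_y t) i j k l)) \<and>
     (\<forall>i<pts X. \<forall>j<pts Y.
        ivp (E_x0 i j) (\<lambda>t. E_x t i j)
          (\<lambda>t. rhs_Ex X Y V W ks (f t) (E_x t) (B_z t) (E_y t) i j) \<and>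
        ivp (B_z0 i j) (\<lambda>t. B_z t i j)
          (\<lambda>t. rhs_Bz X Y V W ks (f t) (E_x t) (B_z t) (E_y t) i j) \<and>
        ivp (E_y0 i j) (\<lambda>t. E_y t i j)
          (\<lambda>t. rhs_Ey X Y V W ks (f t) (E_x t) (B_z t) (E_y t) i j))"

end

(* Energy method. The transport coefficient of each direction z is constant along z, so every
   line of the grid in direction z contributes a quadratic form in D1, which vanishes by
   skew-symmetry. What remains in the derivative of the norm are the stabilization terms, which
   are nonnegative multiples of negative semidefinite forms. *)

theory Submission
  imports Defs
begin

lemma act_eq_sum:
  assumes "A \<in> carrier_mat n n" "i < n"
  shows "act A g i = (\<Sum>j<n. A $$ (i, j) * g j)"
  using assms unfolding act_def by (auto simp: scalar_prod_def lessThan_atLeast0)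

text \<open>Links sums along a grid line to the vector form in which \<open>neg_semidef\<close> is
  stated.\<close>

lemma sum_mult_act_eq_scalar_prod:
  assumes "A \<in> carrier_mat n n"
  shows "(\<Sum>i<n. g i * act A g i) = vec n g \<bullet> (A *\<^sub>v vec n g)"
  using assms unfolding act_def by (auto simp: scalar_prod_def lessThan_atLeast0)

text \<open>Interchanging the two summation indices and applying skew-symmetry turns the quadratic
  form into its own negative.\<close>

lemma sum_mult_act_skew:
  assumes A: "A \<in> carrier_mat n n"
    and skew: "\<And>i j. i < n \<Longrightarrow> j < n \<Longrightarrow> A $$ (i, j) = - A $$ (j, i)"
  shows "(\<Sum>i<n. g i * act A g i) = 0"
proof -
  have eq: "(\<Sum>i<n. g i * act A g i) = (\<Sum>i<n. \<Sum>j<n. g i * (A $$ (i, j) * g j))"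
    by (simp add: act_eq_sum[OF A] sum_distrib_left)
  also have "\<dots> = (\<Sum>j<n. \<Sum>i<n. g i * (A $$ (i, j) * g j))"
    by (rule sum.swap)
  also have "\<dots> = (\<Sum>j<n. \<Sum>i<n. - (g j * (A $$ (j, i) * g i)))"
  proof (intro sum.cong refl)
    fix i j assume "j \<in> {..<n}" "i \<in> {..<n}"
    with skew[of i j] show "g i * (A $$ (i, j) * g j) = - (g j * (A $$ (j, i) * g i))"
      by simp
  qed
  also have "\<dots> = - (\<Sum>i<n. g i * act A g i)"
    unfolding eq by (simp add: sum_negf)
  finally show ?thesis by simp
qed

lemma sbp_carrier [simp]:
  "Dplus d \<in> carrier_mat (pts d) (pts d)" "Dminus d \<in> carrier_mat (pts d) (pts d)"
  "Hmat d \<in> carrier_mat (pts d) (pts d)" "Hinv d \<in> carrier_mat (pts d) (pts d)"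
  "Qplus d \<in> carrier_mat (pts d) (pts d)" "Qminus d \<in> carrier_mat (pts d) (pts d)"
  "Smat d \<in> carrier_mat (pts d) (pts d)" "D1 d \<in> carrier_mat (pts d) (pts d)"
  by (simp_all add: Dplus_def Dminus_def Hmat_def Hinv_def Qplus_def Qminus_def Smat_def D1_def
      stencil_mat_def mult_carrier_mat[where n = "pts d"])

text \<open>\<open>Hmat\<close> and \<open>Hinv\<close> are multiples of the identity, so
  multiplying by them only rescales.\<close>

lemma smult_one_mult_mat:
  fixes A :: "'a::comm_ring_1 mat"
  assumes "A \<in> carrier_mat n m"
  shows "(a \<cdot>\<^sub>m 1\<^sub>m n) * A = a \<cdot>\<^sub>m A"
  using mult_smult_assoc_mat[OF one_carrier_mat assms, of a] left_mult_one_mat[OF assms] by simp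

lemma stp_pos: "periodic_upwind_sbp d \<Longrightarrow> stp d > 0"
  by (simp add: periodic_upwind_sbp_def stp_def)

text \<open>Dividing the SBP relation between \<open>Qplus\<close> and \<open>Qminus\<close> by the
  step shows that \<open>Dplus\<close> is minus the transpose of \<open>Dminus\<close>; transposing
  their average therefore exchanges the two summands up to sign.\<close>

lemma D1_skew:
  assumes d: "periodic_upwind_sbp d" and ij: "i < pts d" "j < pts d"
  shows "D1 d $$ (i, j) = - D1 d $$ (j, i)"
proof -
  have h: "stp d > 0" using d by (rule stp_pos)
  have dims: "dim_row (Dplus d) = pts d" "dim_col (Dplus d) = pts d"
    "dim_row (Dminus d) = pts d" "dim_col (Dminus d) = pts d"
    by (rule carrier_matD[OF sbp_carrier(1)] carrier_matD[OF sbp_carrier(2)])+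
  have "Qplus d = stp d \<cdot>\<^sub>m Dplus d" "Qminus d = stp d \<cdot>\<^sub>m Dminus d"
    unfolding Qplus_def Qminus_def Hmat_def by (simp_all add: smult_one_mult_mat[of _ _ "pts d"])
  with d have Q: "stp d \<cdot>\<^sub>m Dplus d + transpose_mat (stp d \<cdot>\<^sub>m Dminus d) = 0\<^sub>m (pts d) (pts d)"
    by (simp add: periodic_upwind_sbp_def)
  have "stp d * (Dplus d $$ (a, b) + Dminus d $$ (b, a)) = 0" if "a < pts d" "b < pts d" for a b
    using arg_cong[OF Q, of "\<lambda>M. M $$ (a, b)"] that dims by (simp add: distrib_left)
  then have "Dplus d $$ (a, b) = - Dminus d $$ (b, a)" if "a < pts d" "b < pts d" for a b
    using that h by (simp add: eq_neg_iff_add_eq_0)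
  \<comment> \<open>One instance trades \<open>Dplus\<close> at (i, j) for \<open>Dminus\<close> at
    (j, i), the other does the same with the indices exchanged.\<close>
  from this[OF ij] this[OF ij(2,1)] show ?thesis
    using ij dims by (simp add: D1_def algebra_simps)
qed

lemma sum_mult_act_D1:
  assumes "periodic_upwind_sbp d"
  shows "(\<Sum>i<pts d. g i * act (D1 d) g i) = 0"
  by (rule sum_mult_act_skew[OF sbp_carrier(8) D1_skew[OF assms]])

text \<open>Since \<open>Hinv\<close> is a positive scalar times the identity, the form inherits its
  sign from \<open>Smat\<close>.\<close>

lemma sum_mult_act_HinvS:
  assumes d: "periodic_upwind_sbp d"
  shows "(\<Sum>i<pts d. g i * act (Hinv d * Smat d) g i) \<le> 0"
proof -
  let ?u = "vec (pts d) g"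
  have "?u \<bullet> (Smat d *\<^sub>v ?u) \<le> 0"
    using d sbp_carrier(7)[of d] by (auto simp: periodic_upwind_sbp_def neg_semidef_def)
  moreover have "Hinv d * Smat d = inverse (stp d) \<cdot>\<^sub>m Smat d"
    unfolding Hinv_def by (simp add: smult_one_mult_mat[of _ _ "pts d"])
  moreover have "(inverse (stp d) \<cdot>\<^sub>m Smat d) *\<^sub>v ?u = inverse (stp d) \<cdot>\<^sub>v (Smat d *\<^sub>v ?u)"
    using sbp_carrier(7)[of d] by (intro eq_vecI) (auto simp del: sbp_carrier)
  moreover have "?u \<bullet> (inverse (stp d) \<cdot>\<^sub>v (Smat d *\<^sub>v ?u)) = inverse (stp d) * (?u \<bullet> (Smat d *\<^sub>v ?u))"
    by (rule scalar_prod_smult_distrib[OF vec_carrier mult_mat_vec_carrier[OF sbp_carrier(7) vec_carrier]])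
  moreover have "(\<Sum>i<pts d. g i * act (Hinv d * Smat d) g i) = ?u \<bullet> ((Hinv d * Smat d) *\<^sub>v ?u)"
    by (rule sum_mult_act_eq_scalar_prod[OF mult_carrier_mat[OF sbp_carrier(4,7)]])
  ultimately show ?thesis
    using stp_pos[OF d] by (simp add: mult_le_0_iff)
qed

text \<open>The coefficient \<open>c\<close> does not take the index \<open>i\<close>, so it leaves
  the sum over \<open>i\<close>, and each grid line in direction x contributes a one-dimensional
  form. The next three lemmas do the same for y, v and w.\<close>

lemma sum_act4x:
  "(\<Sum>i\<in>I. \<Sum>j\<in>J. \<Sum>k\<in>K. \<Sum>l\<in>L. f i j k l * (c j k l * act4x A f i j k l)) =
   (\<Sum>j\<in>J. \<Sum>k\<in>K. \<Sum>l\<in>L. c j k l * (\<Sum>i\<in>I. f i j k l * act A (\<lambda>n. f n j k l) i))"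
  unfolding sum_distrib_left act4x_def mult.left_commute[of "f _ _ _ _"]
  \<comment> \<open>Fixing \<open>I\<close> makes the rewriting move only this sum, always in one
    direction, so it terminates.\<close>
  by (simp only: sum.swap[of _ _ I])

lemma sum_act4y:
  "(\<Sum>i\<in>I. \<Sum>j\<in>J. \<Sum>k\<in>K. \<Sum>l\<in>L. f i j k l * (c i k l * act4y A f i j k l)) =
   (\<Sum>i\<in>I. \<Sum>k\<in>K. \<Sum>l\<in>L. c i k l * (\<Sum>j\<in>J. f i j k l * act A (\<lambda>n. f i n k l) j))"
  unfolding sum_distrib_left act4y_def mult.left_commute[of "f _ _ _ _"]
  by (simp only: sum.swap[of _ _ J])

lemma sum_act4v:
  "(\<Sum>i\<in>I. \<Sum>j\<in>J. \<Sum>k\<in>K. \<Sum>l\<in>L. f i j k l * (c i j l * act4v A f i j k l)) =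
   (\<Sum>i\<in>I. \<Sum>j\<in>J. \<Sum>l\<in>L. c i j l * (\<Sum>k\<in>K. f i j k l * act A (\<lambda>n. f i j n l) k))"
  unfolding sum_distrib_left act4v_def mult.left_commute[of "f _ _ _ _"]
  by (simp only: sum.swap[of _ _ K])

lemma sum_act4w:
  "(\<Sum>i\<in>I. \<Sum>j\<in>J. \<Sum>k\<in>K. \<Sum>l\<in>L. f i j k l * (c i j k * act4w A f i j k l)) =
   (\<Sum>i\<in>I. \<Sum>j\<in>J. \<Sum>k\<in>K. c i j k * (\<Sum>l\<in>L. f i j k l * act A (\<lambda>n. f i j k n) l))"
  unfolding sum_distrib_left act4w_def mult.left_commute[of "f _ _ _ _"] ..

text \<open>The first two are at least 1. The others are maxima of absolute values, hence dominate
  the value at index 0, which exists because every direction has a grid point.\<close>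

lemma alpha_nonneg:
  assumes "pts X > 0" "pts Y > 0" "pts V > 0" "pts W > 0"
  shows "alpha_x V \<ge> 0" "alpha_y W \<ge> 0" "alpha_v X Y W E B \<ge> 0" "alpha_w X Y V E B \<ge> 0"
proof -
  show "alpha_x V \<ge> 0" "alpha_y W \<ge> 0"
    by (simp_all add: alpha_x_def alpha_y_def max_def)
  have "\<bar>E 0 0 + node W 0 * B 0 0\<bar> \<le> alpha_v X Y W E B"
    unfolding alpha_v_def using assms by (intro Max_ge) (auto intro!: image_eqI[of _ _ "(0, 0, 0)"])
  then show "alpha_v X Y W E B \<ge> 0"
    by (meson abs_ge_zero order_trans)
  have "\<bar>E 0 0 - node V 0 * B 0 0\<bar> \<le> alpha_w X Y V E B"
    unfolding alpha_w_def using assms by (intro Max_ge) (auto intro!: image_eqI[of _ _ "(0, 0, 0)"])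
  then show "alpha_w X Y V E B \<ge> 0"
    by (meson abs_ge_zero order_trans)
qed

text \<open>The sign holds for arbitrary grid functions, so the nonlinear coupling needs no separate
  estimate: the fields enter only as transport coefficients and through nonnegative factors.\<close>

lemma sum_mult_rhs_f_nonpos:
  assumes X: "periodic_upwind_sbp X" and Y: "periodic_upwind_sbp Y"
    and V: "periodic_upwind_sbp V" and W: "periodic_upwind_sbp W"
    and ks: "ks \<ge> 0"
  shows "(\<Sum>i<pts X. \<Sum>j<pts Y. \<Sum>k<pts V. \<Sum>l<pts W.
           f i j k l * rhs_f X Y V W ks f E_x B_z E_y i j k l) \<le> 0"
proof -
  let ?S = "\<lambda>F. \<Sum>i<pts X. \<Sum>j<pts Y. \<Sum>k<pts V. \<Sum>l<pts W. f i j k l * F i j k l"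
  let ?cx = "ks * alpha_x V" and ?cy = "ks * alpha_y W"
  let ?cv = "ks * alpha_v X Y W E_x B_z" and ?cw = "ks * alpha_w X Y V E_y B_z"
  have "pts X > 0" "pts Y > 0" "pts V > 0" "pts W > 0"
    using X Y V W by (simp_all add: periodic_upwind_sbp_def)
  from alpha_nonneg[OF this] ks
  have c: "?cx \<ge> 0" "?cy \<ge> 0" "?cv \<ge> 0" "?cw \<ge> 0" by simp_all
  \<comment> \<open>Each force component is free of its own velocity coordinate: the one in front of
    the v-derivative depends on i, j, l only, the one in front of the w-derivative on i, j, k only.
    The explicit instances of \<open>c\<close> exhibit this.\<close>
  have transport:
    "?S (\<lambda>i j k l. node V k * act4x (D1 X) f i j k l) = 0"
    "?S (\<lambda>i j k l. node W l * act4y (D1 Y) f i j k l) = 0"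
    "?S (\<lambda>i j k l. (E_x i j + node W l * B_z i j) * act4v (D1 V) f i j k l) = 0"
    "?S (\<lambda>i j k l. (E_y i j - node V k * B_z i j) * act4w (D1 W) f i j k l) = 0"
    using X Y V W
    by (simp_all add: sum_act4x[where c = "\<lambda>j k l. node V k"]
        sum_act4y[where c = "\<lambda>i k l. node W l"]
        sum_act4v[where c = "\<lambda>i j l. E_x i j + node W l * B_z i j"]
        sum_act4w[where c = "\<lambda>i j k. E_y i j - node V k * B_z i j"] sum_mult_act_D1)
  \<comment> \<open>The stabilization factors are constant on the whole grid, so the same regrouping
    by lines applies, now with nonnegative weights.\<close>
  have dissipation:
    "?S (\<lambda>i j k l. ?cx * act4x (Hinv X * Smat X) f i j k l) \<le> 0"
    "?S (\<lambda>i j k l. ?cy * act4y (Hinv Y * Smat Y) f i j k l) \<le> 0"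
    "?S (\<lambda>i j k l. ?cv * act4v (Hinv V * Smat V) f i j k l) \<le> 0"
    "?S (\<lambda>i j k l. ?cw * act4w (Hinv W * Smat W) f i j k l) \<le> 0"
    unfolding sum_act4x sum_act4y sum_act4v sum_act4w
    by (intro sum_nonpos mult_nonneg_nonpos c sum_mult_act_HinvS X Y V W)+
  have "?S (rhs_f X Y V W ks f E_x B_z E_y) =
      - ?S (\<lambda>i j k l. node V k * act4x (D1 X) f i j k l)
      - ?S (\<lambda>i j k l. node W l * act4y (D1 Y) f i j k l)
      - ?S (\<lambda>i j k l. (E_x i j + node W l * B_z i j) * act4v (D1 V) f i j k l)
      - ?S (\<lambda>i j k l. (E_y i j - node V k * B_z i j) * act4w (D1 W) f i j k l)
      + ?S (\<lambda>i j k l. ?cx * act4x (Hinv X * Smat X) f i j k l)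
      + ?S (\<lambda>i j k l. ?cy * act4y (Hinv Y * Smat Y) f i j k l)
      + ?S (\<lambda>i j k l. ?cv * act4v (Hinv V * Smat V) f i j k l)
      + ?S (\<lambda>i j k l. ?cw * act4w (Hinv W * Smat W) f i j k l)"
    unfolding sum_negf[symmetric] sum_subtractf[symmetric] sum.distrib[symmetric] rhs_f_def
    by (intro sum.cong refl) (simp add: algebra_simps)
  with transport dissipation show ?thesis by linarith
qed

text \<open>Asserting the existence of a derivative \<open>D\<close> makes differentiability of the
  squared norm part of the claim.\<close>

theorem theorem3p5:
  fixes X Y V W :: direction
    and ks :: real
    and f0 :: grid4 and E_x0 B_z0 E_y0 :: grid2
    and f :: "real \<Rightarrow> grid4" and E_x B_z E_y :: "real \<Rightarrow> grid2"
  assumes "periodic_upwind_sbp X" and "periodic_upwind_sbp Y"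
    and "periodic_upwind_sbp V" and "periodic_upwind_sbp W"
    and "ks \<ge> 1"
    and "vm_solution X Y V W ks f0 E_x0 B_z0 E_y0 f E_x B_z E_y"
  shows "\<forall>t>0. \<exists>D. ((\<lambda>s. norm_sq X Y V W (f s)) has_real_derivative D) (at t) \<and> D \<le> 0"
proof (intro allI impI exI conjI)
  fix t :: real
  assume t: "t > 0"
  let ?h = "stp X * stp Y * stp V * stp W"
  let ?F = "rhs_f X Y V W ks (f t) (E_x t) (B_z t) (E_y t)"
  \<comment> \<open>Twice the weighted inner product of \<open>f t\<close> with its right-hand side.
    The factor 2 stays inside the sums, where termwise differentiation of the squares produces
    it.\<close>
  let ?D = "?h * (\<Sum>i<pts X. \<Sum>j<pts Y. \<Sum>k<pts V. \<Sum>l<pts W. 2 * (f t i j k l * ?F i j k l))"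
  have "((\<lambda>s. f s i j k l) has_real_derivative ?F i j k l) (at t)"
    if "i < pts X" "j < pts Y" "k < pts V" "l < pts W" for i j k l
    using assms(6) that t by (simp add: vm_solution_def ivp_def)
  then have "((\<lambda>s. (f s i j k l)\<^sup>2) has_real_derivative 2 * (f t i j k l * ?F i j k l)) (at t)"
    if "i < pts X" "j < pts Y" "k < pts V" "l < pts W" for i j k l
    using that by (auto intro!: derivative_eq_intros simp: power2_eq_square)
  then show "((\<lambda>s. norm_sq X Y V W (f s)) has_real_derivative ?D) (at t)"
    unfolding norm_sq_def by (intro DERIV_cmult DERIV_sum) auto
  \<comment> \<open>The volume of a grid cell is positive, so \<open>?D\<close> takes its sign from
    the sum.\<close>
  have "?h > 0"
    using assms(1-4) by (simp add: stp_pos)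
  moreover have "(\<Sum>i<pts X. \<Sum>j<pts Y. \<Sum>k<pts V. \<Sum>l<pts W. f t i j k l * ?F i j k l) \<le> 0"
    using assms(1-5) by (intro sum_mult_rhs_f_nonpos) auto
  ultimately show "?D \<le> 0"
    by (simp add: sum_distrib_left[symmetric] mult_le_0_iff)
qed

end
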